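(* Let $\mathcal{H}^r=\mathcal{H}(r,q^2)$ be a non-degenerate Hermitian variety in $\mathrm{PG}(r,q^2)$. Then $$\tau_{r-t}(\mathcal{H}^r)=\begin{cases}0 & \text{if } t>\left\lfloor\frac{r}{2}\right\rfloor,\\ 1 & \text{if } t\le\left\lfloor\frac{r}{2}\right\rfloor.\end{cases}$$
   Context: Here $q$ is a prime power and $\mathrm{PG}(r,q^2)$ is the projective space of projective dimension $r$ over $\mathbb{F}_{q^2}$. Dimensions are projective, with the convention $\dim(\emptyset)=-1$. For a non-empty set $\Omega$ of points of $\mathrm{PG}(r,\mathbb{K})$ and $0\le k\le r$, the $k$-th cutting gap of $\Omega$ is $$\tau_k(\Omega)=k-\min\{\dim\langle\Pi\cap\Omega\rangle : \Pi \text{ a subspace of } \mathrm{PG}(r,\mathbb{K}),\ \dim\Pi=k\}.$$ A non-degenerate Hermitian variety $\mathcal{H}(r,q^2)$ is the set of points of $\mathrm{PG}(r,q^2)$ that are isotropic for a non-degenerate Hermitian form on $\mathbb{F}_{q^2}^{r+1}$ (with respect to the involution $x\mapsto x^q$).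
   Formalization: The subscript r-t is corrected to t: what is proved is τ_t(H^r)=0 if t>⌊r/2⌋ and 1 if t≤⌊r/2⌋, for 0≤t≤r. As printed the claim fails: for r=1, t=0 it gives τ_1=1, but H(1,q²) has q+1≥2 points and spans the line, so τ_1=0. *)

theory Defs
  imports "HOL-Analysis.Cartesian_Space" "HOL-Number_Theory.Prime_Powers"
begin

(* PG(r,K) is modelled on the vector space K^(r+1), written 'a^'n with CARD('n) = r + 1.
   A projective subspace is represented by the vector subspace carrying it; a set of points
   is a set of one-dimensional vector subspaces. *)

definition pg_points :: "(('a::field)^'n) set set" where
  "pg_points = {P. vec.subspace P \<and> vec.dim P = 1}"

definition pdim :: "(('a::field)^'n) set \<Rightarrow> int" where
  "pdim U = int (vec.dim U) - 1"

definition points_of :: "(('a::field)^'n) set \<Rightarrow> ('a^'n) set set" where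
  "points_of U = {P \<in> pg_points. P \<subseteq> U}"

definition pspan :: "(('a::field)^'n) set set \<Rightarrow> ('a^'n) set" where
  "pspan \<Omega> = vec.span (\<Union>\<Omega>)"

(* The set under Min is contained in {-1..k}, hence finite over any field; it is non-empty
   exactly when k < CARD('n), i.e. k \<le> r. *)
definition cutting_gap :: "nat \<Rightarrow> (('a::field)^'n) set set \<Rightarrow> int" where
  "cutting_gap k \<Omega> =
     int k - Min {pdim (pspan (points_of U \<inter> \<Omega>)) | U. vec.subspace U \<and> pdim U = int k}"

(* Over a field of order q^2. Semilinearity in the second argument follows from linearity in
   the first together with the symmetry condition. *)
definition hermitian_form :: "nat \<Rightarrow> (('a::field)^'n \<Rightarrow> 'a^'n \<Rightarrow> 'a) \<Rightarrow> bool" where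
  "hermitian_form q h \<longleftrightarrow>
     (\<forall>x y z. h (x + y) z = h x z + h y z) \<and>
     (\<forall>c x y. h (c *s x) y = c * h x y) \<and>
     (\<forall>x y. h y x = h x y ^ q)"

definition nondegenerate_form :: "(('a::field)^'n \<Rightarrow> 'a^'n \<Rightarrow> 'a) \<Rightarrow> bool" where
  "nondegenerate_form h \<longleftrightarrow> (\<forall>x. (\<forall>y. h x y = 0) \<longrightarrow> x = 0)"

definition isotropic_points :: "(('a::field)^'n \<Rightarrow> 'a^'n \<Rightarrow> 'a) \<Rightarrow> ('a^'n) set set" where
  "isotropic_points h = {P \<in> pg_points. \<forall>v\<in>P. h v v = 0}"

definition nondegenerate_hermitian_variety :: "nat \<Rightarrow> (('a::field)^'n) set set \<Rightarrow> bool" where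
  "nondegenerate_hermitian_variety q H \<longleftrightarrow>
     (\<exists>h. hermitian_form q h \<and> nondegenerate_form h \<and> H = isotropic_points h)"

end

(* Let U be a subspace of vector dimension t + 1. If U contains a non-isotropic vector w and a second
   non-isotropic vector orthogonal to w, then the isotropic vectors of U span U, because the norm onto
   the fixed field of x |-> x^q is surjective. Otherwise U is totally isotropic, or the isotropic vectors
   span exactly the hyperplane W of vectors of U orthogonal to w; so the gap is at most 1. In the last
   case W is orthogonal to all of U, and nondegeneracy gives 2t + 1 <= r + 1. Conversely, for such t
   a totally isotropic W of dimension t with a non-isotropic w orthogonal to it is built by adding one
   isotropic vector at a time, and W + <w> has gap 1. *)

theory Submission
  imports Defs "HOL-Computational_Algebra.Polynomial" "HOL-Number_Theory.Residues"
begin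

section \<open>Power equations in a finite field\<close>

lemma card_power_eq_le:
  fixes a :: "'a::{field,finite}"
  assumes "k > 0"
  shows "card {x. x ^ k = a} \<le> k"
proof -
  define p where "p = Polynomial.monom (1::'a) k - [:a:]"
  have c: "Polynomial.coeff p k = 1"
    using assms by (simp add: p_def coeff_pCons split: nat.split)
  have "p \<noteq> 0" using c by auto
  then have "card {x. poly p x = 0} \<le> degree p" by (rule card_poly_roots_bound)
  also have "degree p \<le> k"
    unfolding p_def by (intro degree_diff_le) (auto simp: degree_monom_le)
  finally show ?thesis by (simp add: p_def poly_monom)
qed

text \<open>Multiplication by \<open>x\<close> permutes the nonzero elements, so it leaves their
  product unchanged; that product can be cancelled.\<close>

lemma finite_field_power_card_minus_1:
  fixes x :: "'a::{field,finite}"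
  assumes "x \<noteq> 0"
  shows "x ^ (CARD('a) - 1) = 1"
proof -
  let ?P = "\<Prod>y\<in>-{0::'a}. y"
  have "bij_betw ((*) x) (-{0}) (-{0})"
    by (rule bij_betwI[where g = "\<lambda>y. y / x"]) (use assms in auto)
  then have "?P = (\<Prod>y\<in>-{0}. x * y)"
    by (rule prod.reindex_bij_betw[symmetric])
  also have "\<dots> = x ^ card (-{0::'a}) * ?P" by (simp add: prod.distrib)
  also have "card (-{0::'a}) = CARD('a) - 1" by (simp add: card_Diff_singleton Compl_eq_Diff_UNIV)
  finally show ?thesis by simp
qed

section \<open>Frobenius, norm and trace over the field of order q^2\<close>

locale finite_hermitian_space =
  fixes q :: nat and h :: "('a::{field,finite})^'n \<Rightarrow> 'a^'n \<Rightarrow> 'a"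
  assumes q: "primepow q" and card_field: "CARD('a) = q\<^sup>2" and herm: "hermitian_form q h"
begin

lemma q_gt_1: "q > 1"
  using q by (rule primepow_gt_Suc_0[unfolded One_nat_def[symmetric]])

lemma q_square_minus_1: "q\<^sup>2 - 1 = (q + 1) * (q - 1)"
  by (simp add: power2_eq_square algebra_simps)

lemma frobenius_add: "(x + y :: 'a) ^ q = x ^ q + y ^ q"
proof -
  obtain p k where p: "prime p" "k > 0" "q = p ^ k"
    using q by (auto simp: primepow_def)
  have "prime CHAR('a)"
    by (rule prime_CHAR_semidom) (simp add: finite_imp_CHAR_pos)
  \<comment> \<open>The order of the field identifies its characteristic with the prime under
    \<open>q\<close>, so that x |-> x^q is an iterate of Frobenius.\<close>
  moreover have "CHAR('a) dvd (p ^ k)\<^sup>2"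
    using CHAR_dvd_CARD[where 'a = 'a] card_field p by simp
  ultimately have "CHAR('a) = p"
    using p(1) by (metis prime_dvd_power primes_dvd_imp_eq)
  then show ?thesis
    using freshmans_dream'[where 'a = 'a, of q k x y] p by simp
qed

text \<open>Counting: the q^2 - 1 nonzero elements lie in fibres of size at most q + 1, so the norm
  takes at least q - 1 nonzero values. They all lie among the roots of y^(q-1) = 1, of which there
  are at most q - 1.\<close>

lemma norm_onto:
  fixes a :: 'a
  assumes "a ^ q = a"
  obtains x where "x ^ (q + 1) = a"
proof (cases "a = 0")
  case True
  then show ?thesis using that[of 0] by simp
next
  case False
  let ?N = "(\<lambda>x::'a. x ^ (q + 1)) ` (-{0})"
  let ?F = "{y::'a. y ^ (q - 1) = 1}"
  have "(x ^ (q + 1)) ^ (q - 1) = 1" if "x \<noteq> 0" for x :: 'a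
    using finite_field_power_card_minus_1[OF that]
    by (simp only: card_field q_square_minus_1 power_mult)
  then have sub: "?N \<subseteq> ?F" by auto
  have "q\<^sup>2 - 1 = card (-{0::'a})"
    by (simp add: card_field card_Diff_singleton Compl_eq_Diff_UNIV)
  also have "\<dots> \<le> (q + 1) * card ?N"
  proof -
    have "-{0::'a} \<subseteq> (\<Union>y\<in>?N. {x. x ^ (q + 1) = y})" by auto
    then have "card (-{0::'a}) \<le> card (\<Union>y\<in>?N. {x. x ^ (q + 1) = y})"
      by (intro card_mono) auto
    also have "\<dots> \<le> (\<Sum>y\<in>?N. card {x. x ^ (q + 1) = y})"
      by (rule card_UN_le) simp
    also have "\<dots> \<le> (\<Sum>y\<in>?N. q + 1)"
      by (intro sum_mono card_power_eq_le) simp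
    finally show ?thesis by (simp add: mult.commute)
  qed
  finally have "q - 1 \<le> card ?N"
    unfolding q_square_minus_1 by (subst (asm) mult_le_cancel1) simp
  moreover have "card ?F \<le> q - 1"
    using q_gt_1 by (intro card_power_eq_le) simp
  ultimately have "?N = ?F"
    by (intro card_seteq sub) auto
  moreover have "a * a ^ (q - 1) = a"
    using assms q_gt_1 by (simp flip: power_Suc)
  ultimately have "a \<in> ?N" using False by auto
  then show ?thesis using that by auto
qed

lemma exists_power_neq:
  obtains a :: 'a where "a \<noteq> 0" "a ^ (q - 1) \<noteq> b"
proof -
  have "card {x::'a. x ^ (q - 1) = b} \<le> q - 1"
    using q_gt_1 by (intro card_power_eq_le) simp
  also have "\<dots> < q\<^sup>2 - 1"
    using q_gt_1 by (simp add: power2_eq_square diff_less_mono)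
  also have "\<dots> = card (-{0::'a})"
    by (simp add: card_field card_Diff_singleton Compl_eq_Diff_UNIV)
  finally have "\<not> -{0} \<subseteq> {x::'a. x ^ (q - 1) = b}"
    using card_mono[of "{x::'a. x ^ (q - 1) = b}" "-{0}"] by auto
  then show ?thesis using that by auto
qed

text \<open>The easy direction of Hilbert 90: every a^(q-1) with \<open>a\<close> nonzero has norm
  1.\<close>

lemma exists_norm_1:
  obtains z :: 'a where "z ^ (q + 1) = 1" "z \<noteq> 1"
proof -
  obtain a :: 'a where a: "a \<noteq> 0" "a ^ (q - 1) \<noteq> 1" by (rule exists_power_neq)
  have "(a ^ (q - 1)) ^ (q + 1) = a ^ (q\<^sup>2 - 1)"
    unfolding q_square_minus_1 power_mult[symmetric] by (simp add: mult.commute)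
  also have "\<dots> = 1"
    using finite_field_power_card_minus_1[OF a(1)] by (simp add: card_field)
  finally show ?thesis using a(2) by (rule that)
qed

text \<open>The element \<open>c\<close> takes the place of 1/2 in polarization, so that even
  \<open>q\<close> needs no separate treatment.\<close>

lemma exists_trace_nonzero:
  obtains c :: 'a where "c + c ^ q \<noteq> 0"
proof -
  obtain c :: 'a where c: "c \<noteq> 0" "c ^ (q - 1) \<noteq> -1" by (rule exists_power_neq)
  have "c + c ^ q = c * (1 + c ^ (q - 1))"
    using q_gt_1 by (simp add: algebra_simps flip: power_Suc)
  moreover have "1 + c ^ (q - 1) \<noteq> 0"
    using c(2) by (metis add.commute add_eq_0_iff)
  ultimately show ?thesis using c(1) that[of c] by simp
qed

section \<open>The form and its orthogonal complements\<close>

lemma h_add_left: "h (x + y) z = h x z + h y z"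
  and h_scale_left: "h (c *s x) y = c * h x y"
  and h_swap: "h y x = h x y ^ q"
  using herm unfolding hermitian_form_def by blast+

lemma h_add_right: "h x (y + z) = h x y + h x z"
  by (metis h_add_left h_swap frobenius_add)

lemma h_scale_right: "h x (c *s y) = c ^ q * h x y"
  by (metis h_scale_left h_swap power_mult_distrib)

lemma h_0_left [simp]: "h 0 x = 0"
  using h_scale_left[of 0 0 x] by simp

lemma h_eq_0_swap: "h x y = 0 \<longleftrightarrow> h y x = 0"
  using q_gt_1 by (subst h_swap) simp

lemma h_0_right [simp]: "h x 0 = 0"
  using h_eq_0_swap h_0_left by blast

definition orth :: "('a^'n) set \<Rightarrow> ('a^'n) set" where
  "orth B = {x. \<forall>y\<in>B. h x y = 0}"

text \<open>Vector counterpart of the span of the points of the variety in \<open>U\<close>;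
  \<open>pspan_isotropic_points\<close> proves the agreement.\<close>

definition isotropic_span :: "('a^'n) set \<Rightarrow> ('a^'n) set" where
  "isotropic_span U = vec.span {v\<in>U. h v v = 0}"

lemma subspace_orth: "vec.subspace (orth B)"
  by (auto simp: orth_def vec.subspace_def h_add_left h_scale_left)

lemma orth_span: "orth (vec.span B) = orth B"
proof
  show "orth B \<subseteq> orth (vec.span B)"
  proof
    fix x assume x: "x \<in> orth B"
    have "vec.subspace {y. h x y = 0}"
      by (auto simp: vec.subspace_def h_add_right h_scale_right)
    moreover have "B \<subseteq> {y. h x y = 0}" using x by (auto simp: orth_def)
    ultimately have "vec.span B \<subseteq> {y. h x y = 0}" by (simp add: vec.span_minimal)
    then show "x \<in> orth (vec.span B)" by (auto simp: orth_def)
  qed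
qed (auto simp: orth_def vec.span_base)

text \<open>Polarization: if h x y were nonzero, a multiple \<open>u\<close> of \<open>x\<close>
  would satisfy h u y = c with \<open>c\<close> of nonzero trace, but isotropy of u + y forces that
  trace to vanish.\<close>

lemma h_eq_0_of_totally_isotropic:
  assumes "vec.subspace U" "\<And>v. v \<in> U \<Longrightarrow> h v v = 0" "x \<in> U" "y \<in> U"
  shows "h x y = 0"
proof (rule ccontr)
  assume nz: "h x y \<noteq> 0"
  obtain c :: 'a where c: "c + c ^ q \<noteq> 0" by (rule exists_trace_nonzero)
  define u where "u = (c / h x y) *s x"
  have u: "u \<in> U" unfolding u_def by (intro vec.subspace_scale assms)
  have huy: "h u y = c" using nz by (simp add: u_def h_scale_left)
  have "h (u + y) (u + y) = 0" by (intro assms vec.subspace_add u)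
  then have "h u y + h y u = 0"
    by (simp add: h_add_left h_add_right add.commute assms(2)[OF u] assms(2)[OF \<open>y \<in> U\<close>])
  then show False using c huy h_swap[of y u] by simp
qed

text \<open>Projection along \<open>a\<close> onto the hyperplane orthogonal to \<open>b\<close>.
  The two vectors are kept apart because in \<open>dim_orth_singleton\<close> the vector
  \<open>b\<close> may lie outside \<open>U\<close>.\<close>

lemma exists_diff_orth:
  assumes U: "vec.subspace U" "x \<in> U" "a \<in> U" and ab: "h a b \<noteq> 0"
  obtains c where "x - c *s a \<in> U \<inter> orth {b}"
proof
  let ?c = "h x b / h a b"
  have "x - ?c *s a \<in> U" by (intro U vec.subspace_diff vec.subspace_scale)
  moreover have "h (x - ?c *s a) b = 0"
    using h_add_left[of "x - ?c *s a" "?c *s a" b] ab by (simp add: h_scale_left)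
  ultimately show "x - ?c *s a \<in> U \<inter> orth {b}" by (auto simp: orth_def)
qed

lemma dim_orth_singleton:
  assumes "vec.subspace U"
  shows "vec.dim U \<le> vec.dim (U \<inter> orth {b}) + 1"
proof (cases "U \<subseteq> orth {b}")
  case True
  then show ?thesis by (simp add: Int_absorb2)
next
  case False
  then obtain a where a: "a \<in> U" "h a b \<noteq> 0" by (auto simp: orth_def)
  have "U \<subseteq> vec.span (insert a (U \<inter> orth {b}))"
  proof
    fix x assume x: "x \<in> U"
    obtain c where "x - c *s a \<in> U \<inter> orth {b}"
      using exists_diff_orth[OF assms x a] .
    then have "x - c *s a \<in> vec.span (U \<inter> orth {b})" by (rule vec.span_base)
    then show "x \<in> vec.span (insert a (U \<inter> orth {b}))"
      by (auto simp: vec.span_breakdown_eq)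
  qed
  then have "vec.dim U \<le> vec.dim (insert a (U \<inter> orth {b}))" by (rule vec.dim_mono)
  then show ?thesis by (simp add: vec.dim_insert split: if_splits)
qed

lemma dim_orth:
  assumes "vec.subspace U" "finite B"
  shows "vec.dim U \<le> vec.dim (U \<inter> orth B) + card B"
  using assms(2)
proof (induction B rule: finite_induct)
  case empty
  then show ?case by (simp add: orth_def)
next
  case (insert b B)
  have "U \<inter> orth (insert b B) = (U \<inter> orth B) \<inter> orth {b}" by (auto simp: orth_def)
  moreover have "vec.subspace (U \<inter> orth B)"
    by (intro vec.subspace_inter assms subspace_orth)
  ultimately have "vec.dim (U \<inter> orth B) \<le> vec.dim (U \<inter> orth (insert b B)) + 1"
    using dim_orth_singleton by metis
  then show ?case using insert by simp
qed

text \<open>Extend a basis \<open>B\<close> of the span of \<open>W\<close> to a basis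
  \<open>C\<close> of the whole space. Vectors of \<open>U\<close> are already orthogonal to
  \<open>B\<close>; the card (C - B) remaining conditions cut \<open>U\<close> down to the radical,
  which is 0.\<close>

lemma dim_add_dim_le:
  assumes "nondegenerate_form h" "vec.subspace U" "U \<subseteq> orth W"
  shows "vec.dim U + vec.dim W \<le> CARD('n)"
proof -
  obtain B where B: "B \<subseteq> W" "vec.independent B" "W \<subseteq> vec.span B" "card B = vec.dim W"
    using vec.basis_exists by blast
  obtain C where C: "B \<subseteq> C" "C \<subseteq> UNIV" "vec.independent C" "UNIV \<subseteq> vec.span C"
    using vec.maximal_independent_subset_extend[OF subset_UNIV B(2)] .
  have spC: "vec.span C = UNIV" using C(4) by auto
  have "card C = vec.dim (UNIV :: ('a^'n) set)"
    using vec.dim_eq_card[of C UNIV] C(3) spC by simp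
  then have cC: "card C = CARD('n)" by (simp only: vec_dim_card)
  have "U \<inter> orth (C - B) \<subseteq> {0}"
  proof
    fix x assume x: "x \<in> U \<inter> orth (C - B)"
    then have "x \<in> orth C" using assms(3) B(1) by (auto simp: orth_def)
    then have "x \<in> orth UNIV"
      using orth_span[of C] spC by simp
    then show "x \<in> {0}" using assms(1) by (auto simp: orth_def nondegenerate_form_def)
  qed
  then have "vec.dim (U \<inter> orth (C - B)) = 0" by simp
  then have "vec.dim U \<le> card (C - B)"
    using dim_orth[OF assms(2) finite, of "C - B"] by linarith
  also have "\<dots> = CARD('n) - vec.dim W"
    using C(1) by (simp add: card_Diff_subset cC B(4))
  moreover have "vec.dim W \<le> CARD('n)"
    using card_mono[OF _ C(1)] cC B(4) by simp
  ultimately show ?thesis by simp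
qed

section \<open>The span of the isotropic vectors of a subspace\<close>

lemma isotropic_span_subset:
  assumes "vec.subspace U"
  shows "isotropic_span U \<subseteq> U"
  unfolding isotropic_span_def using assms by (intro vec.span_minimal) auto

text \<open>On the plane spanned by two orthogonal non-isotropic vectors, \<open>u + c w\<close> is isotropic for every
  solution \<open>c\<close> of a norm equation; two such solutions suffice to span the plane.\<close>

lemma nonisotropic_in_isotropic_span:
  assumes U: "vec.subspace U" and "u \<in> U" "w \<in> U"
    and uw: "h u w = 0" and uu: "h u u \<noteq> 0" and ww: "h w w \<noteq> 0"
  shows "u \<in> isotropic_span U" "w \<in> isotropic_span U"
proof -
  let ?S = "isotropic_span U"
  have S: "vec.subspace ?S" by (simp add: isotropic_span_def)
  define a where "a = - h u u / h w w"
  \<comment> \<open>Deriving this from additivity covers odd and even \<open>q\<close> at once. It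
    makes \<open>a\<close> a fixed element, hence a norm.\<close>
  have m1: "(-1::'a) ^ q = -1"
  proof -
    have "(1 + (-1) :: 'a) ^ q = 1 ^ q + (-1) ^ q" by (rule frobenius_add)
    then show ?thesis using q_gt_1 by (simp add: eq_neg_iff_add_eq_0 add.commute power_0_left)
  qed
  have "a ^ q = a"
    unfolding a_def using h_swap[of u u] h_swap[of w w] m1
    by (metis mult_minus1 power_divide power_mult_distrib)
  then obtain c where c: "c ^ (q + 1) = a" by (rule norm_onto)
  have cnz: "c \<noteq> 0"
    using c uu ww by (auto simp: a_def)
  obtain z :: 'a where z: "z ^ (q + 1) = 1" "z \<noteq> 1" by (rule exists_norm_1)
  have iso: "u + d *s w \<in> ?S" if "d ^ (q + 1) = a" for d
  proof -
    have "h (u + d *s w) (u + d *s w) = h u u + d ^ (q + 1) * h w w"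
      using uw h_eq_0_swap[of u w]
      by (simp add: h_add_left h_add_right h_scale_left h_scale_right)
    also have "\<dots> = 0" by (simp only: that) (simp add: a_def ww)
    finally show ?thesis
      unfolding isotropic_span_def using assms
      by (intro vec.span_base) (auto intro!: vec.subspace_add vec.subspace_scale)
  qed
  have 1: "u + c *s w \<in> ?S" by (rule iso[OF c])
  have 2: "u + (c * z) *s w \<in> ?S"
    by (rule iso) (simp only: power_mult_distrib c z mult_1_right)
  have "(c - c * z) *s w = (u + c *s w) - (u + (c * z) *s w)"
    by (simp add: vec.scale_left_diff_distrib)
  then have "(c - c * z) *s w \<in> ?S" using vec.subspace_diff[OF S 1 2] by simp
  moreover have "c - c * z \<noteq> 0" using cnz z by simp
  ultimately show w: "w \<in> ?S" using vec.subspace_scale[OF S, of "(c - c * z) *s w" "1 / (c - c * z)"]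
    by simp
  have "(u + c *s w) - c *s w \<in> ?S" using w by (intro vec.subspace_diff S 1 vec.subspace_scale)
  then show "u \<in> ?S" by simp
qed

lemma isotropic_span_cases:
  assumes U: "vec.subspace U"
  obtains (full) "isotropic_span U = U"
  | (degenerate) w where "w \<in> U" "h w w \<noteq> 0" "U \<inter> orth {w} \<subseteq> isotropic_span U"
      "\<And>v. v \<in> U \<inter> orth {w} \<Longrightarrow> h v v = 0"
proof (cases "\<exists>w\<in>U. h w w \<noteq> 0")
  case False
  then have "U \<subseteq> isotropic_span U" by (auto simp: isotropic_span_def intro: vec.span_base)
  then show ?thesis using full isotropic_span_subset[OF U] by blast
next
  case True
  then obtain w where w: "w \<in> U" "h w w \<noteq> 0" by blast
  let ?S = "isotropic_span U"
  have S: "vec.subspace ?S" by (simp add: isotropic_span_def)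
  \<comment> \<open>Either \<open>v\<close> is isotropic itself, or \<open>v\<close> and
    \<open>w\<close> form an orthogonal non-isotropic pair.\<close>
  have orthS: "v \<in> ?S" if "v \<in> U" "v \<in> orth {w}" for v
  proof (cases "h v v = 0")
    case True
    then show ?thesis using that by (auto simp: isotropic_span_def intro: vec.span_base)
  next
    case False
    then show ?thesis using nonisotropic_in_isotropic_span(1)[OF U that(1) w(1)] that(2) w(2)
      by (auto simp: orth_def)
  qed
  show ?thesis
  proof (cases "\<forall>v\<in>U \<inter> orth {w}. h v v = 0")
    case True
    then show ?thesis using degenerate[OF w] orthS by auto
  next
    case False
    then obtain u where "u \<in> U" "h u w = 0" "h u u \<noteq> 0" by (auto simp: orth_def)
    then have wS: "w \<in> ?S" using nonisotropic_in_isotropic_span(2)[OF U] w by blast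
    have "U \<subseteq> ?S"
    proof
      fix x assume x: "x \<in> U"
      obtain c where "x - c *s w \<in> U \<inter> orth {w}"
        using exists_diff_orth[OF U x w] .
      then have "x - c *s w \<in> ?S" using orthS by blast
      then have "(x - c *s w) + c *s w \<in> ?S"
        using wS by (intro vec.subspace_add S vec.subspace_scale)
      then show "x \<in> ?S" by simp
    qed
    then show ?thesis using full isotropic_span_subset[OF U] by blast
  qed
qed

lemma dim_isotropic_span_ge:
  assumes U: "vec.subspace U"
  shows "vec.dim U \<le> vec.dim (isotropic_span U) + 1"
  using U
proof (cases rule: isotropic_span_cases)
  case (degenerate w)
  then have "vec.dim (U \<inter> orth {w}) \<le> vec.dim (isotropic_span U)"
    by (intro vec.dim_subset)
  then show ?thesis using dim_orth_singleton[OF U, of w] by simp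
qed simp

text \<open>In the degenerate case W is totally isotropic and orthogonal to \<open>w\<close>, hence
  orthogonal to all of \<open>U\<close>. Then dim U + dim W is at most the dimension n of the whole
  space, while dim W is at least dim U - 1, against the bound on dim U.\<close>

lemma isotropic_span_eq:
  assumes nd: "nondegenerate_form h" and U: "vec.subspace U" and d: "CARD('n) < 2 * vec.dim U - 1"
  shows "isotropic_span U = U"
  using U
proof (cases rule: isotropic_span_cases)
  case (degenerate w)
  let ?W = "U \<inter> orth {w}"
  have W: "vec.subspace ?W" by (intro vec.subspace_inter U subspace_orth)
  have "h x y = 0" if x: "x \<in> U" and y: "y \<in> ?W" for x y
  proof -
    obtain c where "x - c *s w \<in> ?W"
      using exists_diff_orth[OF U x degenerate(1,2)] .
    then have "h (x - c *s w) y = 0"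
      using h_eq_0_of_totally_isotropic[OF W degenerate(4)] y by blast
    moreover have "h w y = 0" using y h_eq_0_swap by (auto simp: orth_def)
    ultimately show ?thesis
      using h_add_left[of "x - c *s w" "c *s w" y] by (simp add: h_scale_left)
  qed
  then have "U \<subseteq> orth ?W" by (auto simp: orth_def)
  then have "vec.dim U + vec.dim ?W \<le> CARD('n)" by (rule dim_add_dim_le[OF nd U])
  then show ?thesis using dim_orth_singleton[OF U, of w] d by simp
qed

section \<open>Subspaces attaining gap 1\<close>

lemma exists_totally_isotropic:
  assumes nd: "nondegenerate_form h" and "2 * t + 1 \<le> CARD('n)"
  shows "\<exists>W w. vec.subspace W \<and> vec.dim W = t \<and> W \<subseteq> orth W \<and> h w w \<noteq> 0 \<and> w \<in> orth W"
  using assms(2)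
proof (induction t)
  case 0
  have "\<exists>w. h w w \<noteq> 0"
  proof (rule ccontr)
    assume "\<nexists>w. h w w \<noteq> 0"
    then have "h x y = 0" for x y
      using h_eq_0_of_totally_isotropic[of UNIV x y] by auto
    then have "x = 0" for x :: "'a^'n" using nd by (auto simp: nondegenerate_form_def)
    then have "(UNIV :: ('a^'n) set) \<subseteq> {0}" by blast
    then have "vec.dim (UNIV :: ('a^'n) set) = 0" by (simp only: vec.dim_eq_0)
    then show False unfolding vec_dim_card by simp
  qed
  then obtain w where "h w w \<noteq> 0" by blast
  then show ?case
    by (intro exI[of _ "{0}"] exI[of _ w]) (auto simp: orth_def)
next
  case (Suc t)
  then obtain W w where W: "vec.subspace W" "vec.dim W = t" "W \<subseteq> orth W"
    and w: "h w w \<noteq> 0" "w \<in> orth W" by fastforce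
  obtain B where B: "B \<subseteq> W" "vec.independent B" "W \<subseteq> vec.span B" "card B = vec.dim W"
    using vec.basis_exists by blast
  have spB: "vec.span B = W" using B W(1) by (simp add: vec.span_subspace)
  \<comment> \<open>Choosing the new vector orthogonal to \<open>w\<close> as well as to
    \<open>W\<close> lets the same \<open>w\<close> serve again. At most t + 1 conditions define
    \<open>X\<close>, and n is at least 2t + 3, so dim X is at least t + 2. Losing at most one
    dimension, the isotropic vectors of \<open>X\<close> still span too much to fit inside
    \<open>W\<close>.\<close>
  define X where "X = orth (insert w B)"
  have X: "vec.subspace X" unfolding X_def by (rule subspace_orth)
  have "CARD('n) \<le> vec.dim X + card (insert w B)"
    using dim_orth[of UNIV "insert w B"] unfolding X_def vec_dim_card by simp
  also have "\<dots> \<le> vec.dim X + (t + 1)"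
    using B(4) W(2) by (simp add: card_insert_if)
  finally have "t < vec.dim (isotropic_span X)"
    using dim_isotropic_span_ge[OF X] Suc.prems by simp
  then have "\<not> {v\<in>X. h v v = 0} \<subseteq> W"
    using vec.dim_subset[of "{v\<in>X. h v v = 0}" W] W(2) by (auto simp: isotropic_span_def)
  then obtain e where e: "e \<in> X" "h e e = 0" "e \<notin> W" by blast
  have eW: "e \<in> orth W" using e(1) orth_span[of B] spB by (auto simp: X_def orth_def)
  have ew: "h w e = 0" using e(1) h_eq_0_swap by (auto simp: X_def orth_def)
  have We: "h x e = 0" if "x \<in> W" for x using eW h_eq_0_swap that by (auto simp: orth_def)
  let ?W = "vec.span (insert e W)"
  have "insert e W \<subseteq> orth (insert e W)"
    using W(3) eW We e(2) by (auto simp: orth_def)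
  then have "?W \<subseteq> orth ?W"
    unfolding orth_span by (intro vec.span_minimal subspace_orth)
  moreover have "w \<in> orth ?W"
    unfolding orth_span using w(2) ew by (auto simp: orth_def)
  moreover have "vec.dim ?W = Suc t"
    using e(3) W by (simp add: vec.dim_insert vec.span_eq_iff[THEN iffD2])
  ultimately show ?case using w(1) by (intro exI[of _ ?W] exI[of _ w]) simp
qed

lemma exists_isotropic_span_hyperplane:
  assumes nd: "nondegenerate_form h" and "2 * t + 1 \<le> CARD('n)"
  obtains U where "vec.subspace U" "vec.dim U = t + 1" "vec.dim (isotropic_span U) \<le> t"
proof -
  obtain W w where W: "vec.subspace W" "vec.dim W = t" "W \<subseteq> orth W"
    and w: "h w w \<noteq> 0" "w \<in> orth W" using exists_totally_isotropic[OF assms] by blast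
  let ?U = "vec.span (insert w W)"
  have spW: "vec.span W = W" using W(1) by (rule vec.span_eq_iff[THEN iffD2])
  have "w \<notin> W" using w by (auto simp: orth_def)
  then have "vec.dim ?U = t + 1" using W(2) by (simp add: vec.dim_insert spW)
  moreover have "{v\<in>?U. h v v = 0} \<subseteq> W"
  proof clarify
    fix v assume "v \<in> ?U" and v: "h v v = 0"
    then obtain c where c: "v - c *s w \<in> W" by (auto simp: vec.span_breakdown_eq spW)
    define a where "a = v - c *s w"
    have a: "a \<in> W" "v = a + c *s w" using c by (auto simp: a_def)
    have "h a a = 0" "h w a = 0" using a W(3) w(2) by (auto simp: orth_def)
    moreover have "h a w = 0" using \<open>h w a = 0\<close> h_eq_0_swap by blast
    \<comment> \<open>Since \<open>a\<close> is isotropic and orthogonal to \<open>w\<close>, this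
      is just the value of h v v.\<close>
    ultimately have "c * c ^ q * h w w = 0"
      using v by (auto simp: a(2) h_add_left h_add_right h_scale_left h_scale_right)
    then have "c = 0" using w(1) by auto
    then show "v \<in> W" using a by simp
  qed
  then have "vec.dim (isotropic_span ?U) \<le> t"
    using vec.dim_subset W(2) by (auto simp: isotropic_span_def)
  ultimately show ?thesis using that[of ?U] by simp
qed

section \<open>From vectors back to points and cutting gaps\<close>

lemma pspan_isotropic_points:
  assumes "vec.subspace U"
  shows "pspan (points_of U \<inter> isotropic_points h) = isotropic_span U"
proof
  show "pspan (points_of U \<inter> isotropic_points h) \<subseteq> isotropic_span U"
    unfolding pspan_def isotropic_span_def
    by (intro vec.span_mono) (auto simp: points_of_def isotropic_points_def)
  have "v \<in> pspan (points_of U \<inter> isotropic_points h)" if v: "v \<in> U" "h v v = 0" for v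
  \<comment> \<open>The zero vector carries no point but lies in every span. So if \<open>U\<close>
    has no isotropic point, both sides are {0}, of projective dimension -1.\<close>
  proof (cases "v = 0")
    case True
    then show ?thesis by (simp add: pspan_def vec.span_zero)
  next
    case False
    have "h x x = 0" if "x \<in> vec.span {v}" for x
      using that v by (auto simp: vec.span_singleton h_scale_left h_scale_right)
    moreover have "vec.span {v} \<subseteq> U" using v assms by (intro vec.span_minimal) auto
    ultimately have "vec.span {v} \<in> points_of U \<inter> isotropic_points h"
      using False by (auto simp: points_of_def isotropic_points_def pg_points_def)
    then show ?thesis
      unfolding pspan_def by (intro vec.span_base) (auto intro: vec.span_base)
  qed
  then show "isotropic_span U \<subseteq> pspan (points_of U \<inter> isotropic_points h)"
    unfolding isotropic_span_def pspan_def by (intro vec.span_minimal) auto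
qed

lemma cutting_gap_isotropic_points:
  assumes nd: "nondegenerate_form h" and t: "t < CARD('n)"
  shows "cutting_gap t (isotropic_points h) = (if CARD('n) < 2 * t + 1 then 0 else 1)"
proof -
  let ?M = "{pdim (pspan (points_of U \<inter> isotropic_points h)) | U. vec.subspace U \<and> pdim U = int t}"
  have M: "?M = (\<lambda>U. int (vec.dim (isotropic_span U)) - 1) ` {U. vec.subspace U \<and> vec.dim U = t + 1}"
  proof -
    have "pdim U = int t \<longleftrightarrow> vec.dim U = t + 1" for U :: "('a^'n) set"
      by (auto simp: pdim_def)
    then have "?M = (\<lambda>U. pdim (pspan (points_of U \<inter> isotropic_points h))) `
        {U. vec.subspace U \<and> vec.dim U = t + 1}" by auto
    also have "\<dots> = (\<lambda>U. int (vec.dim (isotropic_span U)) - 1) ` {U. vec.subspace U \<and> vec.dim U = t + 1}"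
      by (intro image_cong) (auto simp: pdim_def pspan_isotropic_points)
    finally show ?thesis .
  qed
  have fin: "finite ?M" unfolding M by simp
  show ?thesis
  proof (cases "CARD('n) < 2 * t + 1")
    case True
    \<comment> \<open>All values equal t, but a subspace of this dimension must exist for
      \<open>Min\<close> to be taken over a nonempty set.\<close>
    obtain U :: "('a^'n) set" where "vec.subspace U" "vec.dim U = t + 1"
      using vec.choose_subspace_of_subspace[of "t + 1" "UNIV :: ('a^'n) set", unfolded vec_dim_card] t by auto
    moreover have "isotropic_span V = V" if "vec.subspace V" "vec.dim V = t + 1" for V
      using that True by (intro isotropic_span_eq[OF nd]) auto
    ultimately have "?M = {int t}" unfolding M by force
    then show ?thesis using True by (simp add: cutting_gap_def)
  next
    case False
    then obtain U where U: "vec.subspace U" "vec.dim U = t + 1" "vec.dim (isotropic_span U) \<le> t"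
      using exists_isotropic_span_hyperplane[OF nd, of t] by force
    \<comment> \<open>No subspace loses more than one dimension, and \<open>U\<close> loses exactly
      one, so the minimum is t - 1.\<close>
    have lb: "int t - 1 \<le> x" if "x \<in> ?M" for x
      using that dim_isotropic_span_ge unfolding M by force
    have "vec.dim (isotropic_span U) = t" using U dim_isotropic_span_ge[OF U(1)] by simp
    then have "int t - 1 \<in> ?M" unfolding M using U by force
    then have "Min ?M = int t - 1" using lb fin by (intro Min_eqI) auto
    then show ?thesis using False by (simp add: cutting_gap_def)
  qed
qed

end

text \<open>The index \<open>t\<close> is the dimension of the cutting subspace, not its codimension
  as in the subscript r - t of the English formula. The two differ: for t = r \<ge> 1 that formula
  would give gap 0 in dimension 0, where a non-isotropic point gives gap 1.\<close>

theorem theorem4p3: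
  fixes H :: "(('a::{field,finite})^'n) set set" and q r t :: nat
  assumes "primepow q" and "CARD('a) = q\<^sup>2"
    and "CARD('n) = r + 1"
    and "nondegenerate_hermitian_variety q H"
    and "t \<le> r"
  shows "cutting_gap t H = (if t > r div 2 then 0 else 1)"
proof -
  obtain h where h: "hermitian_form q h" "nondegenerate_form h" "H = isotropic_points h"
    using assms(4) by (auto simp: nondegenerate_hermitian_variety_def)
  interpret finite_hermitian_space q h
    using assms h by unfold_locales
  have "CARD('n) < 2 * t + 1 \<longleftrightarrow> t > r div 2" using assms(3) by auto
  then show ?thesis using cutting_gap_isotropic_points[OF h(2), of t] assms(3,5) h(3) by simp
qed

end
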